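(* Let $G$ be a signed complex representing an element of the strong ring, and let $V$ be the set of zero-dimensional cells of $G$. Then the curvature function $K=K_G$ on $V$ satisfies $\sum_{v\in V}K_G(v)=\chi(G)$. If $G=A\times B$ is the product of two signed complexes and $v=(a,b)$ is a zero-dimensional cell of $G$ (with $a,b$ zero-dimensional cells of $A,B$), then $K_G(v)=K_A(a)\,K_B(b)$.
   Context: A finite abstract simplicial complex is a finite set of finite non-empty sets which is closed under taking non-empty subsets; $\dim(x)=|x|-1$. A product complex is a finite Cartesian product $G_1\times\cdots\times G_n$ ($n\ge 1$) of finite abstract simplicial complexes; its cells are the sets $x=x_1\times\cdots\times x_n$ with $x_i\in G_i$, with $\dim(x)=\sum_i\dim(x_i)$ and $\omega(x)=(-1)^{\dim(x)}$. A signed complex is a finite formal disjoint union of product complexes, each summand carrying a sign in $\{1,-1\}$; cells in different summands are disjoint. Products of signed complexes are taken term by term, signs being multiplied (no cancellation is performed). Elements of the strong ring are represented by signed complexes, addition being disjoint union and $-G$ having all signs reversed. The Euler characteristic is $\chi(G)=\sum_x\varepsilon(x)\omega(x)$, the sum being over all cells, where $\varepsilon(x)$ is the sign of the summand containing $x$. The curvature is obtained by distributing the value $\varepsilon(x)\omega(x)$ of each cell $x$ equally to the zero-dimensional cells contained in $x$: $$K_G(v)=\sum_{x\supseteq v}\frac{\varepsilon(x)\,\omega(x)}{|x|},$$ where the sum is over all cells $x$ containing the zero-dimensional cell $v$ and $|x|=\prod_i|x_i|$ is the number of zero-dimensional cells contained in $x=x_1\times\cdots\times x_n$. For a simplicial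 complex this is $K(v)=\sum_{k\ge0}(-1)^kf_k(v)/(k+1)$, with $f_k(v)$ the number of $k$-dimensional simplices containing $v$. *)

theory Defs
  imports Complex_Main
begin

definition simplicial_complex :: "'a set set \<Rightarrow> bool" where
  "simplicial_complex K \<longleftrightarrow>
     finite K \<and> (\<forall>x\<in>K. finite x \<and> x \<noteq> {}) \<and> (\<forall>x\<in>K. \<forall>y. y \<subseteq> x \<and> y \<noteq> {} \<longrightarrow> y \<in> K)"

definition simplex_dim :: "'a set \<Rightarrow> nat" where
  "simplex_dim x = card x - 1"

text \<open>
  A product complex is given by the list of its factors.  The point set of the Cartesian product
  of the sets in a list \<open>xs\<close> is \<open>listset xs\<close>, the set of all lists that choose one element from
  each entry.  In \<open>product_cells\<close> the inner \<open>listset\<close> chooses one simplex \<open>x\<^sub>i\<close> from each factor,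
  the outer one forms the set \<open>x\<^sub>1 \<times> \<dots> \<times> x\<^sub>n\<close>.
\<close>

definition product_complex :: "'a set set list \<Rightarrow> bool" where
  "product_complex Gs \<longleftrightarrow> Gs \<noteq> [] \<and> (\<forall>K\<in>set Gs. simplicial_complex K)"

definition product_cells :: "'a set set list \<Rightarrow> 'a list set set" where
  "product_cells Gs = listset ` listset Gs"

text \<open>
  The factor \<open>x\<^sub>k\<close> of \<open>x = x\<^sub>1 \<times> \<dots> \<times> x\<^sub>n\<close> is recovered as a projection of \<open>x\<close>
  (positions in lists are counted from 0).
\<close>

definition cell_factor :: "nat \<Rightarrow> 'a list set \<Rightarrow> 'a set" where
  "cell_factor k x = (\<lambda>p. p ! k) ` x"

text \<open>
  A finite formal disjoint union of product complexes is a family over a finite index set; a cell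
  of the union is a cell of one summand tagged with the index of that summand.
\<close>

datatype ('i, 'a) signed_family =
  Signed_Family (index: "'i set") (sgn_of: "'i \<Rightarrow> int") (factors: "'i \<Rightarrow> 'a set set list")

type_synonym ('i, 'a) cell = "'i \<times> 'a list set"

definition signed_complex :: "('i, 'a) signed_family \<Rightarrow> bool" where
  "signed_complex G \<longleftrightarrow>
     finite (index G) \<and> (\<forall>i\<in>index G. sgn_of G i \<in> {1, -1} \<and> product_complex (factors G i))"

definition cells :: "('i, 'a) signed_family \<Rightarrow> ('i, 'a) cell set" where
  "cells G = (SIGMA i:index G. product_cells (factors G i))"

definition cell_dim :: "('i, 'a) signed_family \<Rightarrow> ('i, 'a) cell \<Rightarrow> nat" where
  "cell_dim G c = (\<Sum>k<length (factors G (fst c)). simplex_dim (cell_factor k (snd c)))"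

definition cell_omega :: "('i, 'a) signed_family \<Rightarrow> ('i, 'a) cell \<Rightarrow> int" where
  "cell_omega G c = (-1) ^ cell_dim G c"

definition cell_sign :: "('i, 'a) signed_family \<Rightarrow> ('i, 'a) cell \<Rightarrow> int" where
  "cell_sign G c = sgn_of G (fst c)"

definition cell_subset :: "('i, 'a) cell \<Rightarrow> ('i, 'a) cell \<Rightarrow> bool" where
  "cell_subset v c \<longleftrightarrow> fst v = fst c \<and> snd v \<subseteq> snd c"

definition zero_cells :: "('i, 'a) signed_family \<Rightarrow> ('i, 'a) cell set" where
  "zero_cells G = {c \<in> cells G. cell_dim G c = 0}"

definition euler_char :: "('i, 'a) signed_family \<Rightarrow> int" where
  "euler_char G = (\<Sum>c\<in>cells G. cell_sign G c * cell_omega G c)"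

definition curvature :: "('i, 'a) signed_family \<Rightarrow> ('i, 'a) cell \<Rightarrow> real" where
  "curvature G v =
     (\<Sum>c\<in>{c \<in> cells G. cell_subset v c}.
        of_int (cell_sign G c * cell_omega G c) / of_nat (card (snd c)))"

text \<open>
  The summands of a product are indexed by pairs of summands.  The Cartesian product of two sets
  of lists is formed by concatenation, so that \<open>(x\<^sub>1 \<times> \<dots> \<times> x\<^sub>m) \<times> (y\<^sub>1 \<times> \<dots> \<times> y\<^sub>n)\<close> is
  \<open>x\<^sub>1 \<times> \<dots> \<times> x\<^sub>m \<times> y\<^sub>1 \<times> \<dots> \<times> y\<^sub>n\<close>.
\<close>

definition signed_times ::
    "('i, 'a) signed_family \<Rightarrow> ('j, 'a) signed_family \<Rightarrow> ('i \<times> 'j, 'a) signed_family" where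
  "signed_times A B =
     Signed_Family (index A \<times> index B)
       (\<lambda>(i, j). sgn_of A i * sgn_of B j)
       (\<lambda>(i, j). factors A i @ factors B j)"

definition cell_times :: "('i, 'a) cell \<Rightarrow> ('j, 'a) cell \<Rightarrow> ('i \<times> 'j, 'a) cell" where
  "cell_times a b = ((fst a, fst b), {p @ q | p q. p \<in> snd a \<and> q \<in> snd b})"

lemma in_listset_iff: "ys \<in> listset xs \<longleftrightarrow> list_all2 (\<in>) ys xs"
  by (induction xs arbitrary: ys) (auto simp: set_Cons_def list_all2_Cons2)

lemma listset_nonempty: "{} \<notin> set xs \<Longrightarrow> listset xs \<noteq> {}"
  by (induction xs) (auto simp: set_Cons_def)

lemma card_listset: "card (listset xs) = prod_list (map card xs)"
proof (induction xs)
  case (Cons x xs)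
  have "listset (x # xs) = (\<lambda>(a, as). a # as) ` (x \<times> listset xs)"
    by (auto simp: set_Cons_def)
  moreover have "inj_on (\<lambda>(a, as). a # as) (x \<times> listset xs)"
    by (auto simp: inj_on_def)
  ultimately show ?case
    using Cons by (simp add: card_image card_cartesian_product)
qed simp

lemma cell_factor_listset:
  "{} \<notin> set xs \<Longrightarrow> k < length xs \<Longrightarrow> cell_factor k (listset xs) = xs ! k"
proof (induction xs arbitrary: k)
  case (Cons x xs)
  obtain a where a: "a \<in> x" using Cons.prems by (cases "x = {}") auto
  obtain as where as: "as \<in> listset xs" using Cons.prems listset_nonempty[of xs] by auto
  show ?case
  proof (cases k)
    case 0
    then show ?thesis using as by (force simp: cell_factor_def set_Cons_def)
  next
    case (Suc m)
    have "cell_factor k (listset (x # xs)) = cell_factor m (listset xs)"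
      using a Suc by (force simp: cell_factor_def set_Cons_def)
    then show ?thesis using Cons Suc by auto
  qed
qed simp

lemma listset_append: "listset (xs @ ys) = {p @ q | p q. p \<in> listset xs \<and> q \<in> listset ys}"
  by (induction xs) (auto simp: set_Cons_def, (metis append_Cons)+)

lemma signed_complex_times:
  assumes "signed_complex A" "signed_complex B"
  shows "signed_complex (signed_times A B)"
  using assms by (fastforce simp: signed_complex_def signed_times_def product_complex_def)

lemma length_in_listset: "ys \<in> listset xs \<Longrightarrow> length ys = length xs"
  by (auto simp: in_listset_iff list_all2_lengthD)

lemma nonempty_factors:
  assumes "signed_complex G" "i \<in> index G" "xs \<in> listset (factors G i)"
  shows "{} \<notin> set xs"
proof
  assume "{} \<in> set xs"
  then obtain k where k: "k < length xs" "xs ! k = {}" by (auto simp: in_set_conv_nth)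
  then have "{} \<in> factors G i ! k" "factors G i ! k \<in> set (factors G i)"
    using assms(3) by (auto simp: in_listset_iff list_all2_conv_all_nth)
  then show False
    using assms by (auto simp: signed_complex_def product_complex_def simplicial_complex_def)
qed

lemma cell_dim_listset:
  assumes "signed_complex G" "i \<in> index G" "xs \<in> listset (factors G i)"
  shows "cell_dim G (i, listset xs) = sum_list (map simplex_dim xs)"
  using nonempty_factors[OF assms] length_in_listset[OF assms(3)]
  by (simp add: cell_dim_def sum_list_sum_nth atLeast0LessThan cell_factor_listset)

lemma cells_cases:
  assumes "c \<in> cells G"
  obtains i xs where "i \<in> index G" "xs \<in> listset (factors G i)" "c = (i, listset xs)"
  using assms by (auto simp: cells_def product_cells_def)

lemma cells_intro: "i \<in> index G \<Longrightarrow> xs \<in> listset (factors G i) \<Longrightarrow> (i, listset xs) \<in> cells G"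
  by (auto simp: cells_def product_cells_def)

lemma cell_times_listset:
  "cell_times (i, listset xs) (j, listset ys) = ((i, j), listset (xs @ ys))"
  by (simp add: cell_times_def listset_append)

lemma cells_times:
  "cells (signed_times A B) = {cell_times a b | a b. a \<in> cells A \<and> b \<in> cells B}"
proof (intro equalityI subsetI)
  fix c assume "c \<in> cells (signed_times A B)"
  then obtain i j zs where h: "i \<in> index A" "j \<in> index B" "c = ((i, j), listset zs)"
      "zs \<in> listset (factors A i @ factors B j)"
    by (auto simp: cells_def product_cells_def signed_times_def)
  then obtain xs ys where "xs \<in> listset (factors A i)" "ys \<in> listset (factors B j)" "zs = xs @ ys"
    by (auto simp: listset_append)
  with h have "(i, listset xs) \<in> cells A" "(j, listset ys) \<in> cells B"
      "c = cell_times (i, listset xs) (j, listset ys)"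
    by (simp_all add: cells_intro cell_times_listset)
  then show "c \<in> {cell_times a b | a b. a \<in> cells A \<and> b \<in> cells B}" by blast
next
  fix c assume "c \<in> {cell_times a b | a b. a \<in> cells A \<and> b \<in> cells B}"
  then obtain i j xs ys where "i \<in> index A" "j \<in> index B" "xs \<in> listset (factors A i)"
      "ys \<in> listset (factors B j)" "c = cell_times (i, listset xs) (j, listset ys)"
    by (auto elim!: cells_cases)
  then have "(i, j) \<in> index (signed_times A B)" "c = ((i, j), listset (xs @ ys))"
      "xs @ ys \<in> listset (factors (signed_times A B) (i, j))"
    by (auto simp: signed_times_def listset_append cell_times_listset)
  then show "c \<in> cells (signed_times A B)"
    by (simp only: cells_intro)
qed

lemma cell_dim_times:
  assumes "signed_complex A" "signed_complex B" "a \<in> cells A" "b \<in> cells B"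
  shows "cell_dim (signed_times A B) (cell_times a b) = cell_dim A a + cell_dim B b"
proof -
  obtain i xs where a: "i \<in> index A" "xs \<in> listset (factors A i)" "a = (i, listset xs)"
    using assms(3) by (rule cells_cases)
  obtain j ys where b: "j \<in> index B" "ys \<in> listset (factors B j)" "b = (j, listset ys)"
    using assms(4) by (rule cells_cases)
  have "(i, j) \<in> index (signed_times A B)" "xs @ ys \<in> listset (factors (signed_times A B) (i, j))"
    using a b by (auto simp: signed_times_def listset_append)
  then show ?thesis
    using a b assms by (simp add: cell_times_listset cell_dim_listset signed_complex_times)
qed

lemma zero_cells_times:
  assumes "signed_complex A" "signed_complex B"
  shows "zero_cells (signed_times A B) = {cell_times a b | a b. a \<in> zero_cells A \<and> b \<in> zero_cells B}"
  using cell_dim_times[OF assms] by (fastforce simp: zero_cells_def cells_times)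

end

theory Submission
  imports Defs
begin

text \<open>
  The sum formula is a double count.  A cell \<open>x\<^sub>1 \<times> \<dots> \<times> x\<^sub>n\<close> contains exactly as many
  zero-dimensional cells as it has points, since \<open>p \<mapsto> {p}\<close> is a bijection between the two
  (\<open>zero_cells_below\<close>): every \<open>{p\<^sub>1} \<times> \<dots> \<times> {p\<^sub>n}\<close> is a cell because the factors are closed under
  non-empty subsets, and dimension zero forces every factor of a cell to be a singleton.  Each
  cell therefore hands out \<open>|x|\<close> shares of size \<open>\<epsilon>(x)\<omega>(x)/|x|\<close>, and exchanging the summations
  over cells and over zero-dimensional cells recovers its whole value.

  The product formula holds because the share of a cell is multiplicative (\<open>cell_share_times\<close>):
  signs multiply, dimensions add, and numbers of points multiply.  The cells of \<open>A \<times> B\<close> containing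
  \<open>a \<times> b\<close> correspond bijectively to the pairs of a cell of \<open>A\<close> containing \<open>a\<close> and a cell of \<open>B\<close>
  containing \<open>b\<close> (\<open>bij_betw_cells_above_times\<close>), so the sum defining the curvature of the product
  is a product of two sums.  With products of point sets formed by concatenation, this
  correspondence rests on unique splitting: all points in one summand are lists of
  the same length, so a concatenation determines its two parts.
\<close>

section \<open>Points and sizes of cells\<close>

lemma finite_listset: "\<forall>x\<in>set xs. finite x \<Longrightarrow> finite (listset xs)"
  by (induction xs) (auto simp: set_Cons_def intro!: finite_image_set2)

lemma listset_singletons: "listset (map (\<lambda>a. {a}) p) = {p}"
  by (induction p) (auto simp: set_Cons_def)

lemma simplex_of_cell:
  assumes "signed_complex G" "i \<in> index G" "xs \<in> listset (factors G i)" "x \<in> set xs"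
  shows "finite x" "x \<noteq> {}"
proof -
  obtain k where "k < length xs" "x = xs ! k"
    using assms(4) by (auto simp: in_set_conv_nth)
  then have "x \<in> factors G i ! k" "factors G i ! k \<in> set (factors G i)"
    using assms(3) by (auto simp: in_listset_iff list_all2_conv_all_nth)
  then show "finite x" "x \<noteq> {}"
    using assms by (auto simp: signed_complex_def product_complex_def simplicial_complex_def)
qed

lemma finite_cells:
  assumes "signed_complex G"
  shows "finite (cells G)"
  using assms
  by (auto simp: cells_def product_cells_def signed_complex_def product_complex_def
      simplicial_complex_def intro!: finite_SigmaI finite_imageI finite_listset)

lemma finite_points:
  assumes "signed_complex G" "c \<in> cells G"
  shows "finite (snd c)"
proof -
  obtain i xs where "i \<in> index G" "xs \<in> listset (factors G i)" "c = (i, listset xs)"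
    using assms(2) by (rule cells_cases)
  then show ?thesis
    using simplex_of_cell(1)[OF assms(1)] finite_listset[of xs] by simp
qed

lemma points_nonempty:
  assumes "signed_complex G" "c \<in> cells G"
  shows "snd c \<noteq> {}"
proof -
  obtain i xs where "i \<in> index G" "xs \<in> listset (factors G i)" "c = (i, listset xs)"
    using assms(2) by (rule cells_cases)
  then show ?thesis
    using nonempty_factors[OF assms(1)] listset_nonempty[of xs] by simp
qed

text \<open>This is what makes a concatenation of points split in only one way.\<close>

lemma length_point:
  assumes "c \<in> cells G" "p \<in> snd c"
  shows "length p = length (factors G (fst c))"
  using assms by (auto elim!: cells_cases dest!: length_in_listset)

section \<open>Zero-dimensional cells as points\<close>

lemma vertex_simplex:
  assumes "simplicial_complex K" "x \<in> K" "a \<in> x"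
  shows "{a} \<in> K"
proof -
  have "\<forall>y. y \<subseteq> x \<and> y \<noteq> {} \<longrightarrow> y \<in> K"
    using assms(1,2) unfolding simplicial_complex_def by (elim conjE) (rule bspec)
  from this[rule_format, of "{a}"] show ?thesis
    using assms(3) by simp
qed

text \<open>
  Each factor of a cell is finite and non-empty, so zero total dimension leaves one vertex in each
  of them.
\<close>

lemma zero_cell_point:
  assumes "signed_complex G" "v \<in> zero_cells G"
  obtains i p where "v = (i, {p})"
proof -
  obtain i xs where v: "i \<in> index G" "xs \<in> listset (factors G i)" "v = (i, listset xs)"
    using assms(2) by (auto simp: zero_cells_def elim: cells_cases)
  have dim0: "simplex_dim x = 0" if "x \<in> set xs" for x
    using assms(2) v that cell_dim_listset[OF assms(1) v(1,2)] by (simp add: zero_cells_def)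
  have "card x = 1" if "x \<in> set xs" for x
    using dim0[OF that] simplex_of_cell[OF assms(1) v(1,2) that]
    by (simp add: simplex_dim_def card_gt_0_iff le_antisym Suc_leI)
  then have "map card xs = replicate (length xs) 1"
    by (intro nth_equalityI) auto
  then have "card (listset xs) = 1"
    by (simp add: card_listset)
  then show thesis
    using v that by (auto simp: card_1_singleton_iff)
qed

text \<open>
  The point \<open>p = (p\<^sub>1, \<dots>, p\<^sub>n)\<close> is the cell \<open>{p\<^sub>1} \<times> \<dots> \<times> {p\<^sub>n}\<close>; here closure under non-empty
  subsets enters.
\<close>

lemma point_zero_cell:
  assumes "signed_complex G" "c \<in> cells G" "p \<in> snd c"
  shows "(fst c, {p}) \<in> zero_cells G"
proof -
  obtain i xs where c: "i \<in> index G" "xs \<in> listset (factors G i)" "c = (i, listset xs)"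
    using assms(2) by (rule cells_cases)
  have complexes: "simplicial_complex K" if "K \<in> set (factors G i)" for K
    using assms(1) c(1) that by (auto simp: signed_complex_def product_complex_def)
  have len: "length p = length xs" "length xs = length (factors G i)"
    using assms(3) c by (auto dest: length_in_listset)
  have "{p ! k} \<in> factors G i ! k" if k: "k < length p" for k
  proof -
    have "xs ! k \<in> factors G i ! k" "p ! k \<in> xs ! k"
      using c assms(3) k len by (auto simp: in_listset_iff list_all2_conv_all_nth)
    have "simplicial_complex (factors G i ! k)"
      using complexes k len by simp
    then show ?thesis using \<open>xs ! k \<in> factors G i ! k\<close> \<open>p ! k \<in> xs ! k\<close>
      by (rule vertex_simplex)
  qed
  then have mem: "map (\<lambda>a. {a}) p \<in> listset (factors G i)"
    using len by (simp add: in_listset_iff list_all2_conv_all_nth)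
  have "(i, {p}) \<in> cells G"
    using cells_intro[OF c(1) mem] by (simp add: listset_singletons)
  moreover have "cell_dim G (i, {p}) = 0"
    using cell_dim_listset[OF assms(1) c(1) mem]
    by (simp add: listset_singletons simplex_dim_def o_def)
  ultimately show ?thesis
    using c by (simp add: zero_cells_def)
qed

lemma zero_cells_below:
  assumes "signed_complex G" "c \<in> cells G"
  shows "{v \<in> zero_cells G. cell_subset v c} = (\<lambda>p. (fst c, {p})) ` snd c"
proof (intro equalityI subsetI)
  fix v assume "v \<in> {v \<in> zero_cells G. cell_subset v c}"
  then have v: "v \<in> zero_cells G" "cell_subset v c"
    by simp_all
  obtain i p where "v = (i, {p})"
    using assms(1) v(1) by (rule zero_cell_point)
  then show "v \<in> (\<lambda>p. (fst c, {p})) ` snd c"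
    using v(2) by (simp add: cell_subset_def)
next
  fix v assume "v \<in> (\<lambda>p. (fst c, {p})) ` snd c"
  then show "v \<in> {v \<in> zero_cells G. cell_subset v c}"
    using point_zero_cell[OF assms] by (auto simp: cell_subset_def)
qed

lemma card_zero_cells_below:
  assumes "signed_complex G" "c \<in> cells G"
  shows "card {v \<in> zero_cells G. cell_subset v c} = card (snd c)"
  by (simp add: zero_cells_below[OF assms] card_image inj_on_def)

section \<open>Curvature and Euler characteristic\<close>

definition cell_share :: "('i, 'a) signed_family \<Rightarrow> ('i, 'a) cell \<Rightarrow> real" where
  "cell_share G c = of_int (cell_sign G c * cell_omega G c) / of_nat (card (snd c))"

lemma curvature_eq_sum_cell_share:
  "curvature G v = (\<Sum>c\<in>{c \<in> cells G. cell_subset v c}. cell_share G c)"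
  by (simp add: curvature_def cell_share_def)

lemma gauss_bonnet:
  assumes "signed_complex G"
  shows "(\<Sum>v\<in>zero_cells G. curvature G v) = of_int (euler_char G)"
proof -
  have fin: "finite (cells G)" "finite (zero_cells G)"
    using finite_cells[OF assms] by (auto simp: zero_cells_def)
  have "(\<Sum>v\<in>zero_cells G. curvature G v)
      = (\<Sum>c\<in>cells G. \<Sum>v\<in>{v \<in> zero_cells G. cell_subset v c}. cell_share G c)"
    unfolding curvature_eq_sum_cell_share using fin(2,1) by (rule sum.swap_restrict)
  also have "\<dots> = (\<Sum>c\<in>cells G. of_int (cell_sign G c * cell_omega G c))"
  proof (rule sum.cong[OF refl])
    fix c assume c: "c \<in> cells G"
    have "card (snd c) \<noteq> 0"
      using finite_points[OF assms c] points_nonempty[OF assms c] by simp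
    then show "(\<Sum>v\<in>{v \<in> zero_cells G. cell_subset v c}. cell_share G c)
        = of_int (cell_sign G c * cell_omega G c)"
      by (simp add: card_zero_cells_below[OF assms c] cell_share_def)
  qed
  finally show ?thesis
    by (simp add: euler_char_def)
qed

section \<open>Curvature of products\<close>

lemma cell_share_times:
  assumes "signed_complex A" "signed_complex B" "c \<in> cells A" "d \<in> cells B"
  shows "cell_share (signed_times A B) (cell_times c d) = cell_share A c * cell_share B d"
proof -
  have "cell_sign (signed_times A B) (cell_times c d) = cell_sign A c * cell_sign B d"
    by (simp add: cell_sign_def signed_times_def cell_times_def)
  moreover have "cell_omega (signed_times A B) (cell_times c d) = cell_omega A c * cell_omega B d"
    by (simp add: cell_omega_def cell_dim_times[OF assms] power_add)
  moreover have "card (snd (cell_times c d)) = card (snd c) * card (snd d)"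
    using assms(3,4) by (auto elim!: cells_cases simp: cell_times_listset card_listset)
  ultimately show ?thesis
    by (simp add: cell_share_def)
qed

lemma append_in_cell_times_iff:
  assumes "c \<in> cells A" "d \<in> cells B" "length p = length (factors A (fst c))"
  shows "p @ q \<in> snd (cell_times c d) \<longleftrightarrow> p \<in> snd c \<and> q \<in> snd d"
  using assms by (auto simp: cell_times_def dest: length_point)

text \<open>
  Both factors can be read off a product cell, each by fixing a point of the other; this needs the
  point sets to be non-empty.
\<close>

lemma cell_times_inject:
  assumes "signed_complex A" "signed_complex B"
    and "c \<in> cells A" "c' \<in> cells A" "d \<in> cells B" "d' \<in> cells B"
    and eq: "cell_times c d = cell_times c' d'"
  shows "c = c' \<and> d = d'"
proof -
  have fst_eq: "fst c = fst c'" "fst d = fst d'"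
    using eq by (auto simp: cell_times_def)
  obtain p q where pq: "p \<in> snd c" "q \<in> snd d"
    using points_nonempty[OF assms(1,3)] points_nonempty[OF assms(2,5)] by blast
  have iff: "r \<in> snd c \<and> s \<in> snd d \<longleftrightarrow> r \<in> snd c' \<and> s \<in> snd d'"
    if "length r = length (factors A (fst c))" for r s
    using append_in_cell_times_iff[OF assms(3,5) that, of s]
      append_in_cell_times_iff[OF assms(4,6), of r s] that eq fst_eq by simp
  have len: "length r = length (factors A (fst c))" if "r \<in> snd c \<union> snd c'" for r
    using that length_point[OF assms(3), of r] length_point[OF assms(4), of r] fst_eq by auto
  have "snd c = snd c'"
    using iff len pq by blast
  moreover have "snd d = snd d'"
    using iff[OF len, of p] pq by blast
  ultimately show ?thesis
    using fst_eq by (simp add: prod_eq_iff)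
qed

lemma cell_subset_times_iff:
  assumes "signed_complex A" "signed_complex B" "a \<in> zero_cells A" "b \<in> zero_cells B"
    and "c \<in> cells A" "d \<in> cells B"
  shows "cell_subset (cell_times a b) (cell_times c d) \<longleftrightarrow> cell_subset a c \<and> cell_subset b d"
proof -
  obtain i p where a: "a = (i, {p})" by (rule zero_cell_point[OF assms(1,3)])
  obtain j q where b: "b = (j, {q})" by (rule zero_cell_point[OF assms(2,4)])
  have snds: "snd a = {p}" "snd b = {q}" "snd (cell_times a b) = {p @ q}"
    by (simp_all add: a b cell_times_def)
  have len: "length p = length (factors A (fst a))"
    using assms(3) snds length_point[of a A p] by (simp add: zero_cells_def)
  have fsts: "fst (cell_times a b) = (fst a, fst b)" "fst (cell_times c d) = (fst c, fst d)"
    by (simp_all add: cell_times_def)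
  show ?thesis
    using append_in_cell_times_iff[OF assms(5,6), of p q] len
    by (auto simp: cell_subset_def snds fsts)
qed

lemma bij_betw_cells_above_times:
  assumes "signed_complex A" "signed_complex B" "a \<in> zero_cells A" "b \<in> zero_cells B"
  shows "bij_betw (\<lambda>(c, d). cell_times c d)
           ({c \<in> cells A. cell_subset a c} \<times> {d \<in> cells B. cell_subset b d})
           {e \<in> cells (signed_times A B). cell_subset (cell_times a b) e}"
    (is "bij_betw ?f (?C \<times> ?D) ?E")
proof (rule bij_betw_imageI)
  show "inj_on ?f (?C \<times> ?D)"
  proof (rule inj_onI)
    fix e e' assume "e \<in> ?C \<times> ?D" "e' \<in> ?C \<times> ?D" "?f e = ?f e'"
    then have "fst e = fst e' \<and> snd e = snd e'"
      by (intro cell_times_inject[OF assms(1,2)]) (simp_all add: case_prod_unfold mem_Times_iff)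
    then show "e = e'"
      by (simp add: prod_eqI)
  qed
  show "?f ` (?C \<times> ?D) = ?E"
  proof (intro equalityI subsetI)
    fix e assume "e \<in> ?f ` (?C \<times> ?D)"
    then obtain c d where "c \<in> ?C" "d \<in> ?D" "e = cell_times c d"
      by (elim imageE SigmaE) simp
    then show "e \<in> ?E"
      unfolding cells_times using cell_subset_times_iff[OF assms] by blast
  next
    fix e assume "e \<in> ?E"
    then obtain c d where e: "c \<in> cells A" "d \<in> cells B" "e = cell_times c d"
        "cell_subset (cell_times a b) e"
      unfolding cells_times by blast
    then have "(c, d) \<in> ?C \<times> ?D"
      using cell_subset_times_iff[OF assms e(1,2)] by simp
    then show "e \<in> ?f ` (?C \<times> ?D)"
      using e(3) by (intro image_eqI[of _ _ "(c, d)"]) simp_all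
  qed
qed

lemma curvature_times:
  assumes "signed_complex A" "signed_complex B" "a \<in> zero_cells A" "b \<in> zero_cells B"
  shows "curvature (signed_times A B) (cell_times a b) = curvature A a * curvature B b"
proof -
  let ?C = "{c \<in> cells A. cell_subset a c}" and ?D = "{d \<in> cells B. cell_subset b d}"
  have "curvature (signed_times A B) (cell_times a b)
      = (\<Sum>(c, d)\<in>?C \<times> ?D. cell_share (signed_times A B) (cell_times c d))"
    unfolding curvature_eq_sum_cell_share
      sum.reindex_bij_betw[OF bij_betw_cells_above_times[OF assms], symmetric]
    by (simp add: case_prod_unfold)
  also have "\<dots> = (\<Sum>(c, d)\<in>?C \<times> ?D. cell_share A c * cell_share B d)"
    by (rule sum.cong) (auto simp: cell_share_times[OF assms(1,2)])
  also have "\<dots> = curvature A a * curvature B b"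
    by (simp add: curvature_eq_sum_cell_share sum_product sum.cartesian_product)
  finally show ?thesis .
qed

theorem theorem5:
  fixes G :: "('i, 'a) signed_family"
    and A :: "('j, 'b) signed_family"
    and B :: "('k, 'b) signed_family"
    and a :: "('j, 'b) cell"
    and b :: "('k, 'b) cell"
  shows "(signed_complex G \<longrightarrow> (\<Sum>v\<in>zero_cells G. curvature G v) = of_int (euler_char G)) \<and>
    (signed_complex A \<and> signed_complex B \<and> a \<in> zero_cells A \<and> b \<in> zero_cells B \<longrightarrow>
       curvature (signed_times A B) (cell_times a b) = curvature A a * curvature B b)"
  using gauss_bonnet curvature_times by blast

end
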